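(* Let $k\ge 2$ and let $R(x_{k-2},x_{k-1},x_k)$ be a formula of PAF, with free variables $x_{k-2},x_{k-1},x_k$, that represents the relation $r(l,m,n)$ in PAF. Suppose that $R$ is composed of $L_1$ symbols and that the maximal Gödel code among these symbols is $2k+27$ (the code of $x_k$). For a positive integer $L_2$ let $a=(\dots(3!)!\dots)!$ with $L_2$ factorials, let $D(x_k)$ be the formula $$\forall x_{k-2}\bigl((\neg\forall x_{k+1}\neg((\dots((0''')!)!\dots)!=x_{k-2}+x_{k+1}+0'))\to\neg\forall x_{k-1}\neg(R(x_{k-2},x_{k-1},x_k))\bigr)$$ in which the displayed term $(\dots((0''')!)!\dots)!$ contains $L_2$ symbols $!$ (so it denotes $a$), and let $\exists x_kB_D(x_k)$ be the formula $$\neg\forall x_k\Bigl((D(x_k))\to\neg\forall x_{k+2}\bigl((D(x_{k+2}))\to((\forall x_{2k+4}\neg(x_{k+2}=x_k+x_{2k+4}+0')\to\neg\forall x_{2k+5}\neg(x_k=x_{k+2}+x_{2k+5}+0'))\to(\neg\forall x_{2k+6}\neg(x_{k+2}=x_k+x_{2k+6}+0')))\bigr)\Bigr).$$ Let $c$ be the constant (not depending on $L_2$) such that $\exists x_kB_D(x_k)$ is composed of $2L_1+6L_2+c$ symbols. If $L_2>4$, $L_2>2L_1+c+1$ and $2^{L_2}>7L_2(4k+39)$, then the Gödel code of the formula $\exists x_kB_D(x_k)$ is smaller than $a$.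
   Context: PAF is first-order Peano Arithmetic with factorial. Symbols and their Gödel codes: ( has code 3; ) has code 5; comma has code 7; $0$ has code 9; successor $'$ has code 11; $+$ has code 13; $\times$ has code 15; $!$ has code 17; $=$ has code 19; $\neg$ has code 21; $\to$ has code 23; $\forall$ has code 25; the variable $x_k$ has code $2k+27$ ($k=0,1,2,\dots$). Terms: $0$; every variable; and $s'$, $s+t$, $s\times t$, $s!$ for terms $s,t$. Formulas: $s=t$ for terms $s,t$; and $\neg A$, $A\to B$, $\forall x_k(A)$ for formulas $A,B$. Brackets are inserted in terms and formulas wherever needed to make the grouping unambiguous, following a fixed convention. Write $A\wedge B$ for $\neg(A\to\neg B)$ and $\exists x$ for $\neg\forall x\neg$. Axiom schemas ($A,B,C$ any formulas, $x_i,x_j,x_k$ any variables): (10) $A\to(B\to A)$; (11) $(A\to(B\to C))\to((A\to B)\to(A\to C))$; (12) $(\neg A\to\neg B)\to(B\to A)$; (13) $\forall x_kA\to A$, with $x_k$ not free in $A$; (14) $\forall x_kA[x_k]\to A[t]$, with $x_k$ free in $A[x_k]$ and $t$ a term free for $x_k$ in $A[x_k]$; (15) $\forall x_k(A\to B)\to(A\to\forall x_kB)$, with $x_k$ not free in $A$; (16) $x_k=x_k$; (17) $(x_i=x_j)\to(x_j=x_i)$; (18) $(x_i=x_j)\to((x_i=x_k)\to(x_j=x_k))$; (19) $(x_i=x_j)\to(x_i'=x_j')$; (20) $\neg x_k'=0$; (21) $(x_i'=x_j')\to(x_i=x_j)$; (22) $x_k+0=x_k$; (23) $x_i+x_j'=(x_i+x_j)'$;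 (24) $x_k\times0=0$; (25) $x_i\times x_j'=x_i\times x_j+x_i$; (26) $0!=0'$; (27) $(x_k')!=x_k'\times x_k!$; (28) $(A[0]\wedge\forall x_k(A[x_k]\to A[x_k']))\to A[x_k]$, with $x_k$ free in $A[x_k]$. Rules: Modus Ponens (from $A$ and $A\to B$ infer $B$) and Generalization (from $A$ infer $\forall x_kA$). A proof of a formula $F$ is a finite sequence of formulas ending in $F$, each of which is an axiom or follows from earlier ones by a rule. Gödel codes: let $p_i$ be the $(i+1)$th prime ($p_0=2,p_1=3,\dots$). A formula that is the symbol string $\alpha_0\alpha_1\dots\alpha_n$ has Gödel code $p_0^{\#\alpha_0}p_1^{\#\alpha_1}\cdots p_n^{\#\alpha_n}$, where $\#\alpha_i$ is the code of $\alpha_i$. A proof $F_0,\dots,F_n$ has Gödel code $p_0^{\#F_0}\cdots p_n^{\#F_n}$. The numeral $0^{(n)}$ is $0$ followed by $n$ successor symbols. B-formulas: for a formula $A(x)$ with one free variable $x$, the associated B-formula $\exists xB_A(x)$ is, in standard symbols, $$\neg\forall x\bigl(A(x)\to\neg\forall y(A(y)\to((\forall u\neg(y=x+u+0')\to\neg\forall v\neg(x=y+v+0'))\to(\neg\forall w\neg(y=x+w+0'))))\bigr),$$ where $x,y,u,v,w$ are variables of the language; here $A(y)$ is $A$ with $x$ replaced by $y$, bound variables being renamed if needed. It expresses that there is an $x$ that is the least number satisfying $A$. Only formulas of this exact form are called B-formulas. The formula $\neg B_A(n)$ is, in standard symbols, $$A(0^{(n)})\to\neg\forall y(A(y)\to((\forall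 u\neg(y=0^{(n)}+u+0')\to\neg\forall v\neg(0^{(n)}=y+v+0'))\to(\neg\forall w\neg(y=0^{(n)}+w+0')))).$$ The relation $r(l,m,n)$ on natural numbers holds if and only if $l$ is the Gödel code of a B-formula $\exists xB_A(x)$ and $m$ is the Gödel code of a proof in PAF of $\neg B_A(n)$. A formula $R$ represents $r$ in PAF if, for all $l,m,n$, PAF entails $R(0^{(l)},0^{(m)},0^{(n)})$ when $r(l,m,n)$ holds and entails $\neg R(0^{(l)},0^{(m)},0^{(n)})$ when it does not. In the claim, the variables occurring in $D(x_k)$ are among $x_0,\dots,x_{k+1}$. $D(x_{k+2})$ denotes the formula obtained from $D(x_k)$ by renaming its variables injectively to variables among $x_{k+2},\dots,x_{2k+3}$, with the free variable $x_k$ renamed to $x_{k+2}$; it therefore has the same number of symbols as $D(x_k)$. Each formula is identified with its symbol string, including brackets. The constant $c$ accounts for all symbols of $\exists x_kB_D(x_k)$ other than the symbols of the two copies of $R$ and the $3$ symbols "(", ")", "!" per factorial in each of the two occurrences of the term denoting $a$. *)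

theory Defs
  imports Complex_Main "HOL-Computational_Algebra.Primes" "HOL-Library.Infinite_Set"
begin

section \<open>Syntax\<close>

datatype symbol =
  SLeft | SRight | SComma | SZero | SSucc | SPlus | STimes | SFact | SEq | SNeg | SImp | SAll
  | SVar nat

fun symbol_code :: "symbol \<Rightarrow> nat" where
  "symbol_code SLeft = 3"
| "symbol_code SRight = 5"
| "symbol_code SComma = 7"
| "symbol_code SZero = 9"
| "symbol_code SSucc = 11"
| "symbol_code SPlus = 13"
| "symbol_code STimes = 15"
| "symbol_code SFact = 17"
| "symbol_code SEq = 19"
| "symbol_code SNeg = 21"
| "symbol_code SImp = 23"
| "symbol_code SAll = 25"
| "symbol_code (SVar k) = 2 * k + 27"

datatype trm =
  Zero | Var nat | Succ trm | Plus trm trm | Times trm trm | Fct trm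

datatype form =
  Eq trm trm | Neg form | Imp form form | All nat form

definition Conj :: "form \<Rightarrow> form \<Rightarrow> form" where
  "Conj A B = Neg (Imp A (Neg B))"

definition numeral_trm :: "nat \<Rightarrow> trm" where
  "numeral_trm n = (Succ ^^ n) Zero"

primrec tvars :: "trm \<Rightarrow> nat set" where
  "tvars Zero = {}"
| "tvars (Var i) = {i}"
| "tvars (Succ s) = tvars s"
| "tvars (Plus s t) = tvars s \<union> tvars t"
| "tvars (Times s t) = tvars s \<union> tvars t"
| "tvars (Fct s) = tvars s"

text \<open>All variables that occur in a formula, including those next to a quantifier.\<close>

primrec all_vars :: "form \<Rightarrow> nat set" where
  "all_vars (Eq s t) = tvars s \<union> tvars t"
| "all_vars (Neg A) = all_vars A"
| "all_vars (Imp A B) = all_vars A \<union> all_vars B"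
| "all_vars (All i A) = insert i (all_vars A)"

primrec free_vars :: "form \<Rightarrow> nat set" where
  "free_vars (Eq s t) = tvars s \<union> tvars t"
| "free_vars (Neg A) = free_vars A"
| "free_vars (Imp A B) = free_vars A \<union> free_vars B"
| "free_vars (All i A) = free_vars A - {i}"

primrec tsubst :: "nat \<Rightarrow> trm \<Rightarrow> trm \<Rightarrow> trm" where
  "tsubst k t Zero = Zero"
| "tsubst k t (Var i) = (if i = k then t else Var i)"
| "tsubst k t (Succ s) = Succ (tsubst k t s)"
| "tsubst k t (Plus s r) = Plus (tsubst k t s) (tsubst k t r)"
| "tsubst k t (Times s r) = Times (tsubst k t s) (tsubst k t r)"
| "tsubst k t (Fct s) = Fct (tsubst k t s)"

text \<open>\<open>subst k t A\<close> puts \<open>t\<close> for the free occurrences of \<open>x\<^sub>k\<close>. It does not rename bound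
  variables and is only used where \<open>t\<close> is free for \<open>x\<^sub>k\<close> in \<open>A\<close>.\<close>

primrec subst :: "nat \<Rightarrow> trm \<Rightarrow> form \<Rightarrow> form" where
  "subst k t (Eq s r) = Eq (tsubst k t s) (tsubst k t r)"
| "subst k t (Neg A) = Neg (subst k t A)"
| "subst k t (Imp A B) = Imp (subst k t A) (subst k t B)"
| "subst k t (All i A) = (if i = k then All i A else All i (subst k t A))"

primrec free_for :: "trm \<Rightarrow> nat \<Rightarrow> form \<Rightarrow> bool" where
  "free_for t k (Eq s r) = True"
| "free_for t k (Neg A) = free_for t k A"
| "free_for t k (Imp A B) = (free_for t k A \<and> free_for t k B)"
| "free_for t k (All i A) = (k \<notin> free_vars (All i A) \<or> i \<notin> tvars t \<and> free_for t k A)"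

text \<open>Renaming of all variables, free and bound.\<close>

primrec trename :: "(nat \<Rightarrow> nat) \<Rightarrow> trm \<Rightarrow> trm" where
  "trename f Zero = Zero"
| "trename f (Var i) = Var (f i)"
| "trename f (Succ s) = Succ (trename f s)"
| "trename f (Plus s t) = Plus (trename f s) (trename f t)"
| "trename f (Times s t) = Times (trename f s) (trename f t)"
| "trename f (Fct s) = Fct (trename f s)"

primrec rename :: "(nat \<Rightarrow> nat) \<Rightarrow> form \<Rightarrow> form" where
  "rename f (Eq s t) = Eq (trename f s) (trename f t)"
| "rename f (Neg A) = Neg (rename f A)"
| "rename f (Imp A B) = Imp (rename f A) (rename f B)"
| "rename f (All i A) = All (f i) (rename f A)"


section \<open>Provability in PAF\<close>

inductive paf_axiom :: "form \<Rightarrow> bool" where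
  ax10: "paf_axiom (Imp A (Imp B A))"
| ax11: "paf_axiom (Imp (Imp A (Imp B C)) (Imp (Imp A B) (Imp A C)))"
| ax12: "paf_axiom (Imp (Imp (Neg A) (Neg B)) (Imp B A))"
| ax13: "k \<notin> free_vars A \<Longrightarrow> paf_axiom (Imp (All k A) A)"
| ax14: "k \<in> free_vars A \<Longrightarrow> free_for t k A \<Longrightarrow> paf_axiom (Imp (All k A) (subst k t A))"
| ax15: "k \<notin> free_vars A \<Longrightarrow> paf_axiom (Imp (All k (Imp A B)) (Imp A (All k B)))"
| ax16: "paf_axiom (Eq (Var k) (Var k))"
| ax17: "paf_axiom (Imp (Eq (Var i) (Var j)) (Eq (Var j) (Var i)))"
| ax18: "paf_axiom (Imp (Eq (Var i) (Var j)) (Imp (Eq (Var i) (Var k)) (Eq (Var j) (Var k))))"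
| ax19: "paf_axiom (Imp (Eq (Var i) (Var j)) (Eq (Succ (Var i)) (Succ (Var j))))"
| ax20: "paf_axiom (Neg (Eq (Succ (Var k)) Zero))"
| ax21: "paf_axiom (Imp (Eq (Succ (Var i)) (Succ (Var j))) (Eq (Var i) (Var j)))"
| ax22: "paf_axiom (Eq (Plus (Var k) Zero) (Var k))"
| ax23: "paf_axiom (Eq (Plus (Var i) (Succ (Var j))) (Succ (Plus (Var i) (Var j))))"
| ax24: "paf_axiom (Eq (Times (Var k) Zero) Zero)"
| ax25: "paf_axiom (Eq (Times (Var i) (Succ (Var j))) (Plus (Times (Var i) (Var j)) (Var i)))"
| ax26: "paf_axiom (Eq (Fct Zero) (Succ Zero))"
| ax27: "paf_axiom (Eq (Fct (Succ (Var k))) (Times (Succ (Var k)) (Fct (Var k))))"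
| ax28: "k \<in> free_vars A \<Longrightarrow>
    paf_axiom (Imp (Conj (subst k Zero A) (All k (Imp A (subst k (Succ (Var k)) A)))) A)"

definition is_proof :: "form list \<Rightarrow> form \<Rightarrow> bool" where
  "is_proof Fs F \<longleftrightarrow> Fs \<noteq> [] \<and> last Fs = F \<and>
     (\<forall>i<length Fs. paf_axiom (Fs ! i) \<or>
        (\<exists>j<i. \<exists>l<i. Fs ! l = Imp (Fs ! j) (Fs ! i)) \<or>
        (\<exists>j<i. \<exists>x. Fs ! i = All x (Fs ! j)))"

definition paf_provable :: "form \<Rightarrow> bool" where
  "paf_provable F \<longleftrightarrow> (\<exists>Fs. is_proof Fs F)"


section \<open>Symbol strings and bracket conventions\<close>

text \<open>A bracketing tells, for each compound term or formula, whether its operand number \<open>i\<close>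
  (\<open>0\<close> is the first operand, \<open>1\<close> the second) is enclosed in brackets. The equation \<open>s = t\<close> has the
  terms \<open>s\<close> and \<open>t\<close> as operands. The choice may depend on the whole compound expression: in
  \<open>(\<forall>u\<not>(..) \<rightarrow> \<not>\<forall>v\<not>(..)) \<rightarrow> (\<not>\<forall>w\<not>(..))\<close> only the last of the three quantified operands of
  implications is bracketed.\<close>

record bracketing =
  trm_br :: "trm \<Rightarrow> nat \<Rightarrow> bool"
  form_br :: "form \<Rightarrow> nat \<Rightarrow> bool"

definition enclose :: "bool \<Rightarrow> symbol list \<Rightarrow> symbol list" where
  "enclose b w = (if b then [SLeft] @ w @ [SRight] else w)"

primrec trm_string :: "bracketing \<Rightarrow> trm \<Rightarrow> symbol list" where
  "trm_string \<beta> Zero = [SZero]"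
| "trm_string \<beta> (Var i) = [SVar i]"
| "trm_string \<beta> (Succ s) = enclose (trm_br \<beta> (Succ s) 0) (trm_string \<beta> s) @ [SSucc]"
| "trm_string \<beta> (Plus s t) =
     enclose (trm_br \<beta> (Plus s t) 0) (trm_string \<beta> s) @ [SPlus] @
     enclose (trm_br \<beta> (Plus s t) 1) (trm_string \<beta> t)"
| "trm_string \<beta> (Times s t) =
     enclose (trm_br \<beta> (Times s t) 0) (trm_string \<beta> s) @ [STimes] @
     enclose (trm_br \<beta> (Times s t) 1) (trm_string \<beta> t)"
| "trm_string \<beta> (Fct s) = enclose (trm_br \<beta> (Fct s) 0) (trm_string \<beta> s) @ [SFact]"

primrec form_string :: "bracketing \<Rightarrow> form \<Rightarrow> symbol list" where
  "form_string \<beta> (Eq s t) =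
     enclose (form_br \<beta> (Eq s t) 0) (trm_string \<beta> s) @ [SEq] @
     enclose (form_br \<beta> (Eq s t) 1) (trm_string \<beta> t)"
| "form_string \<beta> (Neg A) = [SNeg] @ enclose (form_br \<beta> (Neg A) 0) (form_string \<beta> A)"
| "form_string \<beta> (Imp A B) =
     enclose (form_br \<beta> (Imp A B) 0) (form_string \<beta> A) @ [SImp] @
     enclose (form_br \<beta> (Imp A B) 1) (form_string \<beta> B)"
| "form_string \<beta> (All i A) =
     [SAll, SVar i] @ enclose (form_br \<beta> (All i A) 0) (form_string \<beta> A)"

text \<open>A bracket convention makes the grouping unambiguous, does not depend on the choice of the
  variables, writes the numeral of \<open>n\<close> as \<open>0\<close> followed by \<open>n\<close> successor symbols, and brackets the
  operand of a factorial exactly when it is compound (as in \<open>0!\<close>, \<open>x!\<close>, \<open>(x')!\<close> and \<open>((0''')!)!\<close>).\<close>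

definition bracket_convention :: "bracketing \<Rightarrow> bool" where
  "bracket_convention \<beta> \<longleftrightarrow>
     inj (trm_string \<beta>) \<and> inj (form_string \<beta>) \<and>
     (\<forall>f s i. inj_on f (tvars s) \<longrightarrow> trm_br \<beta> (trename f s) i = trm_br \<beta> s i) \<and>
     (\<forall>f A i. inj_on f (all_vars A) \<longrightarrow> form_br \<beta> (rename f A) i = form_br \<beta> A i) \<and>
     (\<forall>n. \<not> trm_br \<beta> (Succ (numeral_trm n)) 0) \<and>
     (\<forall>s. trm_br \<beta> (Fct s) 0 \<longleftrightarrow> \<not> (s = Zero \<or> (\<exists>j. s = Var j)))"


section \<open>Goedel codes\<close>

definition nth_prime :: "nat \<Rightarrow> nat" where
  "nth_prime i = enumerate {p. prime p} i"

definition seq_code :: "nat list \<Rightarrow> nat" where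
  "seq_code cs = (\<Prod>i<length cs. nth_prime i ^ (cs ! i))"

definition form_code :: "bracketing \<Rightarrow> form \<Rightarrow> nat" where
  "form_code \<beta> A = seq_code (map symbol_code (form_string \<beta> A))"

definition proof_code :: "bracketing \<Rightarrow> form list \<Rightarrow> nat" where
  "proof_code \<beta> Fs = seq_code (map (form_code \<beta>) Fs)"


section \<open>B-formulas\<close>

text \<open>\<open>alpha E A B\<close>: the formulas agree up to names of bound variables, where \<open>E\<close> lists the pairs of
  corresponding variables, innermost first. In particular, if \<open>x\<close> is the only free variable of
  \<open>A\<close>, then \<open>alpha [(x, y)] A A'\<close> says that \<open>A'\<close> is \<open>A\<close> with \<open>x\<close> replaced by \<open>y\<close>, with
  bound variables possibly renamed and without capture of \<open>y\<close>.\<close>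

fun var_match :: "(nat \<times> nat) list \<Rightarrow> nat \<Rightarrow> nat \<Rightarrow> bool" where
  "var_match [] a b \<longleftrightarrow> a = b"
| "var_match ((u, v) # E) a b \<longleftrightarrow> a = u \<and> b = v \<or> a \<noteq> u \<and> b \<noteq> v \<and> var_match E a b"

fun talpha :: "(nat \<times> nat) list \<Rightarrow> trm \<Rightarrow> trm \<Rightarrow> bool" where
  "talpha E Zero Zero \<longleftrightarrow> True"
| "talpha E (Var a) (Var b) \<longleftrightarrow> var_match E a b"
| "talpha E (Succ s) (Succ s') \<longleftrightarrow> talpha E s s'"
| "talpha E (Plus s t) (Plus s' t') \<longleftrightarrow> talpha E s s' \<and> talpha E t t'"
| "talpha E (Times s t) (Times s' t') \<longleftrightarrow> talpha E s s' \<and> talpha E t t'"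
| "talpha E (Fct s) (Fct s') \<longleftrightarrow> talpha E s s'"
| "talpha E _ _ \<longleftrightarrow> False"

fun alpha :: "(nat \<times> nat) list \<Rightarrow> form \<Rightarrow> form \<Rightarrow> bool" where
  "alpha E (Eq s t) (Eq s' t') \<longleftrightarrow> talpha E s s' \<and> talpha E t t'"
| "alpha E (Neg A) (Neg A') \<longleftrightarrow> alpha E A A'"
| "alpha E (Imp A B) (Imp A' B') \<longleftrightarrow> alpha E A A' \<and> alpha E B B'"
| "alpha E (All u A) (All v A') \<longleftrightarrow> alpha ((u, v) # E) A A'"
| "alpha E _ _ \<longleftrightarrow> False"

text \<open>\<open>less_eqn s v t\<close> is the equation \<open>t = s + v + 0'\<close>, with the sum grouped to the left.\<close>

definition less_eqn :: "trm \<Rightarrow> nat \<Rightarrow> trm \<Rightarrow> form" where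
  "less_eqn s v t = Eq t (Plus (Plus s (Var v)) (Succ Zero))"

text \<open>The common shape of the matrix of a B-formula (\<open>t\<close> a variable \<open>x\<close>, \<open>At = A(x)\<close>) and of
  \<open>\<not>B\<^sub>A(n)\<close> (\<open>t\<close> the numeral of \<open>n\<close>, \<open>At = A(t)\<close>); \<open>Ay\<close> is \<open>A(y)\<close>.\<close>

definition not_least ::
  "trm \<Rightarrow> form \<Rightarrow> nat \<Rightarrow> form \<Rightarrow> nat \<Rightarrow> nat \<Rightarrow> nat \<Rightarrow> form" where
  "not_least t At y Ay u v w =
     Imp At (Neg (All y (Imp Ay
       (Imp (Imp (All u (Neg (less_eqn t u (Var y))))
                 (Neg (All v (Neg (less_eqn (Var y) v t)))))
            (Neg (All w (Neg (less_eqn t w (Var y)))))))))"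

definition exB ::
  "nat \<Rightarrow> form \<Rightarrow> nat \<Rightarrow> form \<Rightarrow> nat \<Rightarrow> nat \<Rightarrow> nat \<Rightarrow> form" where
  "exB x A y Ay u v w = Neg (All x (not_least (Var x) A y Ay u v w))"

definition notB ::
  "nat \<Rightarrow> nat \<Rightarrow> form \<Rightarrow> nat \<Rightarrow> form \<Rightarrow> nat \<Rightarrow> nat \<Rightarrow> nat \<Rightarrow> form" where
  "notB n x A y Ay u v w =
     not_least (numeral_trm n) (subst x (numeral_trm n) A) y Ay u v w"

definition B_data ::
  "nat \<Rightarrow> form \<Rightarrow> nat \<Rightarrow> form \<Rightarrow> nat \<Rightarrow> nat \<Rightarrow> nat \<Rightarrow> bool" where
  "B_data x A y Ay u v w \<longleftrightarrow>
     free_vars A = {x} \<and> distinct [x, y, u, v, w] \<and> alpha [(x, y)] A Ay"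

definition rel_r :: "bracketing \<Rightarrow> nat \<Rightarrow> nat \<Rightarrow> nat \<Rightarrow> bool" where
  "rel_r \<beta> l m n \<longleftrightarrow>
     (\<exists>x A y Ay u v w Fs. B_data x A y Ay u v w \<and>
        l = form_code \<beta> (exB x A y Ay u v w) \<and>
        is_proof Fs (notB n x A y Ay u v w) \<and> m = proof_code \<beta> Fs)"

text \<open>\<open>R\<close>, whose arguments are \<open>x\<^sub>i\<close>, \<open>x\<^sub>j\<close>, \<open>x\<^sub>k\<close> in this order, represents the ternary
  relation \<open>r\<close>. As numerals are closed, the order of the substitutions is immaterial.\<close>

definition represents ::
  "form \<Rightarrow> nat \<Rightarrow> nat \<Rightarrow> nat \<Rightarrow> (nat \<Rightarrow> nat \<Rightarrow> nat \<Rightarrow> bool) \<Rightarrow> bool" where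
  "represents R i j k r \<longleftrightarrow>
     (\<forall>l m n.
        let Rlmn = subst i (numeral_trm l) (subst j (numeral_trm m) (subst k (numeral_trm n) R))
        in (r l m n \<longrightarrow> paf_provable Rlmn) \<and> (\<not> r l m n \<longrightarrow> paf_provable (Neg Rlmn)))"


section \<open>The formula D and its B-formula\<close>

definition iter_fact :: "nat \<Rightarrow> nat" where
  "iter_fact L = (fact ^^ L) 3"

definition iter_fact_trm :: "nat \<Rightarrow> trm" where
  "iter_fact_trm L = (Fct ^^ L) (numeral_trm 3)"

definition formD :: "nat \<Rightarrow> form \<Rightarrow> nat \<Rightarrow> form" where
  "formD k R L =
     All (k - 2)
       (Imp (Neg (All (k + 1) (Neg (less_eqn (Var (k - 2)) (k + 1) (iter_fact_trm L)))))
            (Neg (All (k - 1) (Neg R))))"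

definition renames_D :: "nat \<Rightarrow> form \<Rightarrow> (nat \<Rightarrow> nat) \<Rightarrow> bool" where
  "renames_D k D \<rho> \<longleftrightarrow>
     inj_on \<rho> (all_vars D) \<and> \<rho> ` all_vars D \<subseteq> {k + 2..2 * k + 3} \<and> \<rho> k = k + 2"

text \<open>\<open>\<rho>\<close> is the renaming of variables that turns \<open>D(x\<^sub>k)\<close> into \<open>D(x\<^bsub>k+2\<^esub>)\<close>.\<close>

definition exB_D :: "nat \<Rightarrow> form \<Rightarrow> (nat \<Rightarrow> nat) \<Rightarrow> nat \<Rightarrow> form" where
  "exB_D k R \<rho> L =
     exB k (formD k R L) (k + 2) (rename \<rho> (formD k R L)) (2 * k + 4) (2 * k + 5) (2 * k + 6)"

end

theory Submission
  imports Defs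
begin

text \<open>The code is at most the \<open>(4 * k + 39)\<close>-th power of the product of the first
  \<open>n < 7 * L\<^sub>2\<close> primes, because \<open>x\<^bsub>2k+6\<^esub>\<close> is the symbol with the largest code.
  Euclid's argument already bounds that product by \<open>2 ^ 2 ^ n\<close>, while from \<open>4\<close> factorials on the
  iterated factorial exceeds \<open>2 ^ 2 ^ (8 * L\<^sub>2)\<close>. So no estimate for the distribution of
  primes is needed.\<close>

lemma nth_prime_prime: "prime (nth_prime i)"
  using enumerate_in_set[OF primes_infinite] by (simp add: nth_prime_def)

text \<open>Euclid's argument: a prime dividing the product plus one is none of the first
  \<open>n\<close> primes, since it would then divide 1. Its index is therefore at least
  \<open>n\<close>.\<close>

lemma nth_prime_le_prod_Suc: "nth_prime n \<le> (\<Prod>i<n. nth_prime i) + 1"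
proof -
  let ?P = "\<Prod>i<n. nth_prime i"
  have "?P > 0"
    using nth_prime_prime prime_gt_0_nat by (simp add: prod_pos)
  then obtain q where q: "prime q" "q dvd ?P + 1"
    using prime_factor_nat[of "?P + 1"] by auto
  obtain m where m: "q = nth_prime m"
    using q(1) range_enumerate[OF primes_infinite] unfolding nth_prime_def
    by (metis imageE mem_Collect_eq)
  have "\<not> m < n"
  proof
    assume "m < n"
    then have "q dvd ?P"
      unfolding m by (intro dvd_prodI) auto
    with q show False
      by (metis dvd_add_right_iff not_prime_unit)
  qed
  then have "nth_prime n \<le> q"
    unfolding m nth_prime_def using primes_infinite by (simp add: enumerate_mono_le_iff)
  also have "q \<le> ?P + 1"
    using q(2) by (rule dvd_imp_le) simp
  finally show ?thesis .
qed

lemma prod_nth_prime_less: "(\<Prod>i<n. nth_prime i) < 2 ^ 2 ^ n"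
proof (induction n)
  case (Suc n)
  \<comment> \<open>Strictness of the induction hypothesis absorbs the \<open>+ 1\<close> in
    Euclid's bound, so \<open>nth_prime n\<close> is at most \<open>2 ^ 2 ^ n\<close>.\<close>
  have "(\<Prod>i<Suc n. nth_prime i) \<le> (\<Prod>i<n. nth_prime i) * 2 ^ 2 ^ n"
    using nth_prime_le_prod_Suc[of n] Suc by simp
  also have "\<dots> < 2 ^ 2 ^ n * 2 ^ 2 ^ n"
    using Suc by simp
  also have "\<dots> = 2 ^ 2 ^ Suc n"
    by (simp flip: power_add mult_2)
  finally show ?case .
qed simp

lemma seq_code_le:
  assumes "\<And>x. x \<in> set cs \<Longrightarrow> x \<le> M"
  shows "seq_code cs \<le> 2 ^ (2 ^ length cs * M)"
proof -
  have "seq_code cs \<le> (\<Prod>i<length cs. nth_prime i ^ M)"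
    unfolding seq_code_def using assms nth_prime_prime
    by (intro prod_mono) (auto intro!: power_increasing prime_ge_1_nat)
  also have "\<dots> = (\<Prod>i<length cs. nth_prime i) ^ M"
    by (simp add: prod_power_distrib)
  also have "\<dots> \<le> (2 ^ 2 ^ length cs) ^ M"
    using prod_nth_prime_less[of "length cs"] by (intro power_mono) auto
  finally show ?thesis
    by (simp add: power_mult)
qed

text \<open>The induction starts at 4 because 3! = 6 is still below 8; each step multiplies the left
  side by 2 and the right side by \<open>Suc n\<close>.\<close>

lemma power2_le_fact: "n \<ge> 4 \<Longrightarrow> 2 ^ n \<le> (fact n :: nat)"
proof (induction n rule: dec_induct)
  case (step n)
  then have "2 * 2 ^ n \<le> Suc n * (fact n :: nat)"
    by (intro mult_le_mono) auto
  then show ?case by simp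
qed (simp add: fact_numeral)

lemma iter_fact_Suc: "iter_fact (Suc L) = fact (iter_fact L)"
  by (simp add: iter_fact_def)

lemma iter_fact_2: "iter_fact 2 = 720"
  by (simp add: iter_fact_def numeral_2_eq_2 fact_numeral)

text \<open>The bound fails for \<open>L = 3\<close>, as 720! is below \<open>2 ^ 7200\<close>. From
  4 on, each further factorial contributes at least one exponential, which outweighs the growth from
  \<open>8 * L\<close> to \<open>8 * Suc L\<close>.\<close>

lemma iter_fact_gt: "L \<ge> 4 \<Longrightarrow> 2 ^ 2 ^ (8 * L) < iter_fact L"
proof (induction L rule: dec_induct)
  case base
  have ge3: "2 ^ 720 \<le> iter_fact 3"
    using power2_le_fact[of "iter_fact 2"] iter_fact_Suc[of 2] iter_fact_2 by (simp del: fact_numeral)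
  have "2 ^ (8 * 4) < (2::nat) ^ 720"
    by (rule power_strict_increasing) auto
  also note ge3
  finally have "(2::nat) ^ 2 ^ (8 * 4) < 2 ^ iter_fact 3"
    by (rule power_strict_increasing) simp
  \<comment> \<open>An aside within the chain: \<open>power2_le_fact\<close> requires an argument of
    at least 4.\<close>
  also have "(2::nat) ^ 2 \<le> 2 ^ 720"
    by (rule power_increasing) auto
  with ge3 have "4 \<le> iter_fact 3"
    by simp
  then have "2 ^ iter_fact 3 \<le> iter_fact (Suc 3)"
    unfolding iter_fact_Suc by (rule power2_le_fact)
  also have "Suc 3 = 4"
    by simp
  finally show ?case .
next
  case (step L)
  \<comment> \<open>It suffices to place \<open>2 ^ (8 * Suc L)\<close> below
    \<open>iter_fact L\<close>; the next factorial then supplies the outer power of 2.\<close>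
  have "8 * Suc L \<le> 8 * (2 * L)"
    using step by simp
  also have "\<dots> \<le> 2 ^ 4 * 2 ^ L"
    using less_exp[of L] by simp
  also have "\<dots> \<le> 2 ^ (8 * L)"
    unfolding power_add[symmetric] using step by (intro power_increasing) auto
  finally have "(2::nat) ^ (8 * Suc L) \<le> 2 ^ 2 ^ (8 * L)"
    by (intro power_increasing) auto
  also note step.IH
  finally have *: "2 ^ (8 * Suc L) < iter_fact L" .
  have "(2::nat) ^ 2 \<le> 2 ^ (8 * Suc L)"
    by (intro power_increasing) auto
  with * have "4 \<le> iter_fact L"
    by simp
  from * have "(2::nat) ^ 2 ^ (8 * Suc L) < 2 ^ iter_fact L"
    by (intro power_strict_increasing) auto
  also have "\<dots> \<le> iter_fact (Suc L)"
    using \<open>4 \<le> iter_fact L\<close> by (simp add: iter_fact_Suc power2_le_fact)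
  finally show ?case .
qed

lemma SVar_in_enclose [simp]: "SVar i \<in> set (enclose b w) \<longleftrightarrow> SVar i \<in> set w"
  by (auto simp: enclose_def)

lemma SVar_in_trm_string: "SVar i \<in> set (trm_string \<beta> s) \<longleftrightarrow> i \<in> tvars s"
  by (induction s) auto

lemma SVar_in_form_string: "SVar i \<in> set (form_string \<beta> A) \<longleftrightarrow> i \<in> all_vars A"
  by (induction A) (auto simp: SVar_in_trm_string)

text \<open>The symbols other than variables have codes up to 25 only, so the bound for variables
  covers them even when \<open>m = 0\<close>.\<close>

lemma symbol_code_le:
  assumes "\<And>i. s = SVar i \<Longrightarrow> i \<le> m"
  shows "symbol_code s \<le> 2 * m + 27"
  using assms by (cases s) auto

lemma form_code_le:
  assumes "\<And>i. i \<in> all_vars A \<Longrightarrow> i \<le> m"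
  shows "form_code \<beta> A \<le> 2 ^ (2 ^ length (form_string \<beta> A) * (2 * m + 27))"
proof -
  have "symbol_code s \<le> 2 * m + 27" if "s \<in> set (form_string \<beta> A)" for s
    using that assms by (intro symbol_code_le) (auto simp: SVar_in_form_string)
  then show ?thesis
    unfolding form_code_def using seq_code_le[of "map symbol_code (form_string \<beta> A)" "2 * m + 27"]
    by auto
qed

lemma tvars_trename: "tvars (trename f s) = f ` tvars s"
  by (induction s) auto

lemma all_vars_rename: "all_vars (rename f A) = f ` all_vars A"
  by (induction A) (auto simp: tvars_trename)

lemma tvars_iter_fact_trm: "tvars (iter_fact_trm L) = {}"
proof -
  have "tvars (numeral_trm n) = {}" for n
    unfolding numeral_trm_def by (induction n) auto
  then show ?thesis
    unfolding iter_fact_trm_def by (induction L) auto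
qed

text \<open>This controls the bound variables as well, about which \<open>free_vars\<close> says
  nothing.\<close>

lemma all_vars_le_of_Max:
  assumes "Max (symbol_code ` set (form_string \<beta> A)) = 2 * m + 27" and "i \<in> all_vars A"
  shows "i \<le> m"
proof -
  have "symbol_code (SVar i) \<le> Max (symbol_code ` set (form_string \<beta> A))"
    using assms(2) by (intro Max_ge imageI) (auto simp: SVar_in_form_string)
  with assms(1) show ?thesis by simp
qed

text \<open>The indices reach at most \<open>k + 1\<close> in D and \<open>2 * k + 3\<close> in its
  renamed copy; the three comparison variables come on top.\<close>

lemma all_vars_exB_D_le:
  assumes R: "\<And>i. i \<in> all_vars R \<Longrightarrow> i \<le> k"
    and \<rho>: "renames_D k (formD k R L) \<rho>"
    and i: "i \<in> all_vars (exB_D k R \<rho> L)"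
  shows "i \<le> 2 * k + 6"
proof -
  let ?D = "formD k R L"
  have D: "j \<le> 2 * k + 6" if "j \<in> all_vars ?D" for j
    using that R[of j] by (auto simp: formD_def less_eqn_def tvars_iter_fact_trm)
  have \<rho>D: "j \<le> 2 * k + 6" if "j \<in> all_vars (rename \<rho> ?D)" for j
    using that \<rho> unfolding renames_D_def all_vars_rename by fastforce
  show ?thesis
    using i D \<rho>D by (auto simp: exB_D_def exB_def not_least_def less_eqn_def)
qed

theorem theorem2:
  fixes \<beta> :: bracketing and R :: form and \<rho> :: "nat \<Rightarrow> nat"
    and k L\<^sub>1 L\<^sub>2 c :: nat
  assumes "bracket_convention \<beta>"
    and "k \<ge> 2"
    and "free_vars R = {k - 2, k - 1, k}"
    and "represents R (k - 2) (k - 1) k (rel_r \<beta>)"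
    and "length (form_string \<beta> R) = L\<^sub>1"
    and "Max (symbol_code ` set (form_string \<beta> R)) = 2 * k + 27"
    and "L\<^sub>2 > 0"
    and "renames_D k (formD k R L\<^sub>2) \<rho>"
    and "\<And>L. L > 0 \<Longrightarrow> length (form_string \<beta> (exB_D k R \<rho> L)) = 2 * L\<^sub>1 + 6 * L + c"
    and "L\<^sub>2 > 4"
    and "L\<^sub>2 > 2 * L\<^sub>1 + c + 1"
    and "2 ^ L\<^sub>2 > 7 * L\<^sub>2 * (4 * k + 39)"
  shows "form_code \<beta> (exB_D k R \<rho> L\<^sub>2) < iter_fact L\<^sub>2"
proof -
  let ?E = "exB_D k R \<rho> L\<^sub>2"
  let ?n = "length (form_string \<beta> ?E)"
  have "form_code \<beta> ?E \<le> 2 ^ (2 ^ ?n * (2 * (2 * k + 6) + 27))"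
    using all_vars_exB_D_le[OF all_vars_le_of_Max[OF assms(6)] assms(8)] by (rule form_code_le)
  also have "\<dots> \<le> 2 ^ 2 ^ (8 * L\<^sub>2)"
  proof (rule power_increasing)
    \<comment> \<open>The factor 1 gives the product shape that \<open>mult_le_mono1\<close>
      compares.\<close>
    have "2 * (2 * k + 6) + 27 = 1 * (4 * k + 39)"
      by simp
    also have "\<dots> \<le> 7 * L\<^sub>2 * (4 * k + 39)"
      using \<open>L\<^sub>2 > 0\<close> by (intro mult_le_mono1) simp
    also have "\<dots> \<le> 2 ^ L\<^sub>2"
      using assms(12) by simp
    \<comment> \<open>The length \<open>2 * L\<^sub>1 + 6 * L\<^sub>2 + c\<close> is below
      \<open>7 * L\<^sub>2\<close> because \<open>L\<^sub>2\<close> exceeds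
      \<open>2 * L\<^sub>1 + c + 1\<close>; the largest symbol code costs one more
      \<open>L\<^sub>2\<close> in the exponent.\<close>
    finally have "2 ^ ?n * (2 * (2 * k + 6) + 27) \<le> 2 ^ (7 * L\<^sub>2) * 2 ^ L\<^sub>2"
      using assms(7,9,11) by (intro mult_le_mono power_increasing) auto
    then show "2 ^ ?n * (2 * (2 * k + 6) + 27) \<le> (2::nat) ^ (8 * L\<^sub>2)"
      by (simp flip: power_add)
  qed simp
  also have "\<dots> < iter_fact L\<^sub>2"
    using assms(10) by (intro iter_fact_gt) simp
  finally show ?thesis .
qed

end
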